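(* If there exists a complete uniform nested SQS$(v)$, then there exists a minimum uniform nested SQS$(2v)$.
   Context: A Steiner quadruple system SQS$(v)$ is a pair $(Q,\mathcal{B})$ where $Q$ is a set of $v$ points and $\mathcal{B}$ is a collection of 4-subsets of $Q$ (blocks) such that every 3-subset of $Q$ is contained in exactly one block. A nested SQS$(v)$ is an SQS$(v)$ together with a partition of each block into two 2-subsets (pairs). A pair of points is an ND-pair if it is one of the two pairs in the partition of at least one block; the multiplicity of a pair is the number of blocks whose partition contains that pair. A nested SQS is uniform if all its ND-pairs have the same multiplicity. A complete uniform nested SQS$(v)$ is a uniform nested SQS$(v)$ in which all $\binom{v}{2}$ pairs of points are ND-pairs (then necessarily each has multiplicity $\frac{v-2}{6}$). A minimum uniform nested SQS$(v)$ is a uniform nested SQS$(v)$ with exactly $\frac{v}{2}\left(\frac{v}{2}-1\right)$ ND-pairs (then necessarily each has multiplicity $\frac{v-1}{3}$). *)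

theory Defs
  imports Complex_Main "HOL-Library.Disjoint_Sets"
begin

definition SQS :: "nat \<Rightarrow> 'a set \<Rightarrow> 'a set set \<Rightarrow> bool" where
  "SQS v Q B \<longleftrightarrow>
     finite Q \<and> card Q = v \<and>
     (\<forall>b\<in>B. b \<subseteq> Q \<and> card b = 4) \<and>
     (\<forall>T. T \<subseteq> Q \<and> card T = 3 \<longrightarrow> (\<exists>!b. b \<in> B \<and> T \<subseteq> b))"

text \<open>The nesting is a function \<open>N\<close> that sends a block to the set of the two pairs into which
  it is partitioned. Only its values on blocks matter.\<close>

definition nested_SQS ::
    "nat \<Rightarrow> 'a set \<Rightarrow> 'a set set \<Rightarrow> ('a set \<Rightarrow> 'a set set) \<Rightarrow> bool" where
  "nested_SQS v Q B N \<longleftrightarrow>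
     SQS v Q B \<and>
     (\<forall>b\<in>B. partition_on b (N b) \<and> card (N b) = 2 \<and> (\<forall>p\<in>N b. card p = 2))"

definition ND_pairs :: "'a set set \<Rightarrow> ('a set \<Rightarrow> 'a set set) \<Rightarrow> 'a set set" where
  "ND_pairs B N = {p. \<exists>b\<in>B. p \<in> N b}"

definition multiplicity :: "'a set set \<Rightarrow> ('a set \<Rightarrow> 'a set set) \<Rightarrow> 'a set \<Rightarrow> nat" where
  "multiplicity B N p = card {b \<in> B. p \<in> N b}"

definition uniform_nested_SQS ::
    "nat \<Rightarrow> 'a set \<Rightarrow> 'a set set \<Rightarrow> ('a set \<Rightarrow> 'a set set) \<Rightarrow> bool" where
  "uniform_nested_SQS v Q B N \<longleftrightarrow>
     nested_SQS v Q B N \<and>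
     (\<forall>p\<in>ND_pairs B N. \<forall>q\<in>ND_pairs B N. multiplicity B N p = multiplicity B N q)"

definition complete_uniform_nested_SQS ::
    "nat \<Rightarrow> 'a set \<Rightarrow> 'a set set \<Rightarrow> ('a set \<Rightarrow> 'a set set) \<Rightarrow> bool" where
  "complete_uniform_nested_SQS v Q B N \<longleftrightarrow>
     uniform_nested_SQS v Q B N \<and> ND_pairs B N = {p. p \<subseteq> Q \<and> card p = 2}"

text \<open>The number of pairs is compared in the reals, so that neither the halving nor the
  subtraction is truncated.\<close>

definition minimum_uniform_nested_SQS ::
    "nat \<Rightarrow> 'a set \<Rightarrow> 'a set set \<Rightarrow> ('a set \<Rightarrow> 'a set set) \<Rightarrow> bool" where
  "minimum_uniform_nested_SQS v Q B N \<longleftrightarrow>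
     uniform_nested_SQS v Q B N \<and>
     real (card (ND_pairs B N)) = real v / 2 * (real v / 2 - 1)"

end

theory Submission imports Defs begin

text \<open>This is the doubling construction on two copies of the points, the layers of \<open>Q \<times> UNIV\<close>. The
  blocks of the doubled system are \<open>p \<times> UNIV\<close> for a pair \<open>p\<close>, and the lifts of old blocks that meet
  each layer in an even number of points. A block with two points in each layer is split into its
  two layers, a block inside a single layer as in the old system. Then the ND-pairs are the
  \<open>v (v - 1)\<close> pairs inside a layer, and a copy of \<open>p\<close> has multiplicity \<open>1 + r + m\<close>, where
  \<open>r = (v - 2) / 2\<close> is the number of old blocks containing \<open>p\<close> and \<open>m\<close> is the old multiplicity.\<close>

section \<open>Counting blocks of a Steiner quadruple system\<close>

lemma SQS_finite_blocks: "SQS v Q B \<Longrightarrow> finite B"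
  unfolding SQS_def by (auto intro: finite_subset[of B "Pow Q"])

lemma SQS_unique_block:
  "SQS v Q B \<Longrightarrow> T \<subseteq> Q \<Longrightarrow> card T = 3 \<Longrightarrow> \<exists>!b. b \<in> B \<and> T \<subseteq> b"
  unfolding SQS_def by blast

lemma SQS_blockD:
  assumes "SQS v Q B" "b \<in> B"
  shows "b \<subseteq> Q" "card b = 4" "finite b"
  using assms finite_subset[of b Q] unfolding SQS_def by auto

text \<open>Each point outside \<open>p\<close> completes \<open>p\<close> to a triple, which lies
  in exactly one block. So the blocks through \<open>p\<close>, with \<open>p\<close> removed, cut
  \<open>Q - p\<close> into disjoint sets of two points. The subtraction is exact, since
  \<open>Q\<close> contains \<open>p\<close>.\<close>

lemma SQS_pair_degree:
  assumes S: "SQS v Q B" and p: "p \<subseteq> Q" "card p = 2"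
  shows "2 * card {b \<in> B. p \<subseteq> b} = v - 2"
proof -
  let ?D = "{b \<in> B. p \<subseteq> b}"
  have fp: "finite p" using p(2) card.infinite by fastforce
  have point: "\<exists>!b. b \<in> B \<and> insert x p \<subseteq> b" if "x \<in> Q - p" for x
    using SQS_unique_block[OF S, of "insert x p"] that p fp by simp
  have ex: "\<exists>b\<in>?D. x \<in> b" if "x \<in> Q - p" for x
    using point[OF that] by auto
  have uniq: "b = c" if "b \<in> ?D" "c \<in> ?D" "x \<in> b - p" "x \<in> c - p" for b c x
    using point[of x] SQS_blockD(1)[OF S, of b] that by auto
  have "Q - p = (\<Union>b\<in>?D. b - p)"
  proof
    show "Q - p \<subseteq> (\<Union>b\<in>?D. b - p)" using ex by fast
    show "(\<Union>b\<in>?D. b - p) \<subseteq> Q - p" using SQS_blockD(1)[OF S] by fast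
  qed
  moreover have "card (\<Union>b\<in>?D. b - p) = (\<Sum>b\<in>?D. card (b - p))"
  proof (rule card_UN_disjoint)
    show "finite ?D" using SQS_finite_blocks[OF S] by simp
    show "\<forall>b\<in>?D. finite (b - p)" using SQS_blockD(3)[OF S] by simp
    show "\<forall>b\<in>?D. \<forall>c\<in>?D. b \<noteq> c \<longrightarrow> (b - p) \<inter> (c - p) = {}"
      using uniq by (meson disjoint_iff)
  qed
  moreover have "card (b - p) = 2" if "b \<in> ?D" for b
    using that SQS_blockD[OF S, of b] fp p(2) by (simp add: card_Diff_subset)
  ultimately have "card (Q - p) = 2 * card ?D" by simp
  moreover have "card (Q - p) = v - 2"
    using p fp S by (simp add: card_Diff_subset SQS_def)
  ultimately show ?thesis by simp
qed

section \<open>Nested systems and their images under injective maps\<close>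

lemma partition_on_doubleton:
  "A \<noteq> {} \<Longrightarrow> C \<noteq> {} \<Longrightarrow> A \<inter> C = {} \<Longrightarrow> partition_on (A \<union> C) {A, C}"
  by (auto simp: partition_on_def disjoint_def)

lemma nested_SQS_pairD:
  assumes "nested_SQS v Q B N" "b \<in> B" "p \<in> N b"
  shows "p \<subseteq> b" "card p = 2"
  using assms unfolding nested_SQS_def partition_on_def by auto

text \<open>Blocks and nesting pairs are all subsets of \<open>Q\<close>, and on
  \<open>Pow Q\<close> taking images under \<open>f\<close> is injective. Hence \<open>f\<close>
  carries the blocks counted for \<open>p\<close> bijectively to those counted for its
  image.\<close>

lemma nested_SQS_multiplicity_image:
  assumes S: "nested_SQS v Q B N" and f: "inj_on f Q" and p: "p \<subseteq> Q"
    and N': "\<And>b. b \<in> B \<Longrightarrow> N' (f ` b) = (`) f ` N b"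
  shows "multiplicity ((`) f ` B) N' (f ` p) = multiplicity B N p"
proof -
  have BQ: "B \<subseteq> Pow Q"
    using S by (auto simp: nested_SQS_def SQS_def)
  have "{b \<in> (`) f ` B. f ` p \<in> N' b} = (`) f ` {b \<in> B. p \<in> N b}"
  proof -
    have "f ` p \<in> N' (f ` b) \<longleftrightarrow> p \<in> N b" if b: "b \<in> B" for b
    proof -
      have "N b \<subseteq> Pow Q"
        using nested_SQS_pairD(1)[OF S b] b BQ by blast
      then show ?thesis
        unfolding N'[OF b] using inj_on_image_mem_iff[OF inj_on_image_Pow[OF f], of p "N b"] p
        by simp
    qed
    then show ?thesis by auto
  qed
  moreover have "inj_on ((`) f) {b \<in> B. p \<in> N b}"
    by (rule inj_on_subset[OF inj_on_image_Pow[OF f]]) (use BQ in auto)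
  ultimately show ?thesis
    unfolding multiplicity_def by (simp add: card_image)
qed

lemma nested_SQS_image:
  assumes S: "nested_SQS v Q B N" and f: "inj_on f Q"
    and N': "\<And>b. b \<in> B \<Longrightarrow> N' (f ` b) = (`) f ` N b"
  shows "nested_SQS v (f ` Q) ((`) f ` B) N'"
proof -
  have S0: "SQS v Q B" using S by (simp add: nested_SQS_def)
  have BQ: "B \<subseteq> Pow Q" using S0 by (auto simp: SQS_def)
  have "\<exists>!b. b \<in> (`) f ` B \<and> T \<subseteq> b" if T: "T \<subseteq> f ` Q" "card T = 3" for T
  proof -
    obtain U where U: "U \<subseteq> Q" "T = f ` U" using T(1) by (auto simp: subset_image_iff)
    have "card U = 3" using T(2) U card_image[OF inj_on_subset[OF f U(1)]] by simp
    then obtain b where b: "b \<in> B" "U \<subseteq> b" and uniq: "\<And>c. c \<in> B \<Longrightarrow> U \<subseteq> c \<Longrightarrow> c = b"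
      using SQS_unique_block[OF S0 U(1)] by blast
    show ?thesis
    proof (rule ex1I[of _ "f ` b"])
      show "f ` b \<in> (`) f ` B \<and> T \<subseteq> f ` b" using b U by blast
      fix c assume "c \<in> (`) f ` B \<and> T \<subseteq> c"
      then obtain d where d: "d \<in> B" "c = f ` d" "f ` U \<subseteq> f ` d" using U by blast
      \<comment> \<open>Injectivity on all of \<open>Q\<close> turns the inclusion of images back
        into an inclusion, so uniqueness of the old block applies.\<close>
      then have "U \<subseteq> d" using f U(1) BQ by (auto dest!: inj_onD subsetD)
      then show "c = f ` b" using uniq d by blast
    qed
  qed
  moreover have "card (f ` b) = 4" if "b \<in> B" for b
    using that SQS_blockD[OF S0 that] card_image[OF inj_on_subset[OF f]] by simp
  ultimately have S': "SQS v (f ` Q) ((`) f ` B)"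
    using S0 image_mono[of _ Q f] unfolding SQS_def by (simp add: card_image[OF f])
  have "partition_on (f ` b) (N' (f ` b)) \<and> card (N' (f ` b)) = 2 \<and> (\<forall>p\<in>N' (f ` b). card p = 2)"
    if b: "b \<in> B" for b
  proof -
    have N: "partition_on b (N b)" "card (N b) = 2" "\<forall>p\<in>N b. card p = 2"
      using S b unfolding nested_SQS_def by auto
    have fb: "inj_on f b" by (rule inj_on_subset[OF f]) (use BQ b in auto)
    have NP: "N b \<subseteq> Pow b" using N(1) by (auto simp: partition_on_def)
    have "partition_on (f ` b) ((`) f ` N b)"
    proof (rule partition_onI)
      show "\<Union>((`) f ` N b) = f ` b"
        using N(1) by (auto simp: partition_on_def)
      show "disjnt P R" if PR: "P \<in> (`) f ` N b" "R \<in> (`) f ` N b" "P \<noteq> R" for P R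
      proof -
        obtain p q where pq: "p \<in> N b" "q \<in> N b" "P = f ` p" "R = f ` q" using PR by blast
        then have "p \<noteq> q" using PR(3) by blast
        then have "p \<inter> q = {}" using pq N(1) by (auto simp: partition_on_def disjoint_def)
        then show ?thesis using inj_on_image_Int[OF fb, of p q] NP pq by (auto simp: disjnt_def)
      qed
      show "{} \<notin> (`) f ` N b"
        using N(1) by (auto simp: partition_on_def)
    qed
    moreover have "card ((`) f ` N b) = 2"
      using card_image[OF inj_on_subset[OF inj_on_image_Pow[OF fb] NP]] N(2) by simp
    moreover have "card (f ` p) = 2" if "p \<in> N b" for p
      using card_image[OF inj_on_subset[OF fb]] NP N(3) that by auto
    ultimately show ?thesis unfolding N'[OF b] by auto
  qed
  then show ?thesis using S' unfolding nested_SQS_def by auto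
qed

text \<open>This moves a system to another point type; the doubled points are of type
  \<open>'a \<times> bool\<close>, while the theorem asks for natural numbers.\<close>

lemma minimum_uniform_nested_SQS_image:
  assumes M: "minimum_uniform_nested_SQS v Q B N" and f: "inj_on f Q"
  shows "\<exists>N'. minimum_uniform_nested_SQS v (f ` Q) ((`) f ` B) N'"
proof -
  \<comment> \<open>The image of a block determines the block, because \<open>f\<close> is injective
    on \<open>Q\<close>. The nesting of the image block is thus the image of the old
    nesting.\<close>
  define N' where "N' c = (`) f ` N (the_inv_into B ((`) f) c)" for c
  have U: "uniform_nested_SQS v Q B N" using M by (simp add: minimum_uniform_nested_SQS_def)
  then have S: "nested_SQS v Q B N" by (simp add: uniform_nested_SQS_def)
  have BQ: "B \<subseteq> Pow Q" using S by (auto simp: nested_SQS_def SQS_def)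
  have N': "N' (f ` b) = (`) f ` N b" if "b \<in> B" for b
    unfolding N'_def using the_inv_into_f_f[OF inj_on_subset[OF inj_on_image_Pow[OF f] BQ] that]
    by simp
  have ND: "ND_pairs ((`) f ` B) N' = (`) f ` ND_pairs B N"
    unfolding ND_pairs_def using N' by auto
  have NDQ: "ND_pairs B N \<subseteq> Pow Q"
    unfolding ND_pairs_def using nested_SQS_pairD(1)[OF S] BQ by blast
  have "uniform_nested_SQS v (f ` Q) ((`) f ` B) N'"
    unfolding uniform_nested_SQS_def
  proof (intro conjI ballI)
    show "nested_SQS v (f ` Q) ((`) f ` B) N'" by (rule nested_SQS_image[OF S f N'])
    fix p q assume "p \<in> ND_pairs ((`) f ` B) N'" "q \<in> ND_pairs ((`) f ` B) N'"
    then obtain p' q' where pq: "p' \<in> ND_pairs B N" "q' \<in> ND_pairs B N" "p = f ` p'" "q = f ` q'"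
      unfolding ND by blast
    then have "multiplicity B N p' = multiplicity B N q'"
      using U unfolding uniform_nested_SQS_def by blast
    moreover have "p' \<subseteq> Q" "q' \<subseteq> Q" using pq NDQ by auto
    ultimately show "multiplicity ((`) f ` B) N' p = multiplicity ((`) f ` B) N' q"
      using nested_SQS_multiplicity_image[OF S f _ N'] unfolding pq by metis
  qed
  moreover have "card (ND_pairs ((`) f ` B) N') = card (ND_pairs B N)"
    unfolding ND by (rule card_image[OF inj_on_subset[OF inj_on_image_Pow[OF f] NDQ]])
  ultimately show ?thesis
    using M unfolding minimum_uniform_nested_SQS_def by metis
qed

section \<open>Layers and the doubled quadruple system\<close>

definition layer :: "('a \<times> bool) set \<Rightarrow> bool \<Rightarrow> 'a set" where
  "layer t i = {x. (x, i) \<in> t}"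

text \<open>The index says which layer receives the first set. An argument can therefore put a
  chosen layer first and need not treat \<open>False\<close> and \<open>True\<close>
  separately.\<close>

definition glue :: "bool \<Rightarrow> 'a set \<Rightarrow> 'a set \<Rightarrow> ('a \<times> bool) set" where
  "glue i A C = A \<times> {i} \<union> C \<times> {\<not> i}"

lemma layer_glue [simp]: "layer (glue i A C) i = A" "layer (glue i A C) (\<not> i) = C"
  by (auto simp: layer_def glue_def)

lemma layer_Times [simp]: "layer (A \<times> I) i = (if i \<in> I then A else {})"
  by (auto simp: layer_def)

lemma glue_layer: "glue i (layer t i) (layer t (\<not> i)) = t"
  by (cases i) (auto simp: layer_def glue_def, (metis (full_types))+)

lemma glue_subset_iff: "glue i X Y \<subseteq> t \<longleftrightarrow> X \<subseteq> layer t i \<and> Y \<subseteq> layer t (\<not> i)"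
  by (auto simp: layer_def glue_def)

lemma glue_eq_iff: "glue i A C = glue i A' C' \<longleftrightarrow> A = A' \<and> C = C'"
  by (metis layer_glue)

lemma card_glue: "finite A \<Longrightarrow> finite C \<Longrightarrow> card (glue i A C) = card A + card C"
  unfolding glue_def by (subst card_Un_disjoint) (auto simp: card_cartesian_product)

text \<open>The first alternative is a doubled pair. In the second, the single evenness condition
  covers the splittings 4+0, 2+2 and 0+4 of an old block.\<close>

definition double_layers :: "'a set \<Rightarrow> 'a set set \<Rightarrow> 'a set \<Rightarrow> 'a set \<Rightarrow> bool" where
  "double_layers Q B A C \<longleftrightarrow>
     A = C \<and> A \<subseteq> Q \<and> card A = 2 \<or> A \<union> C \<in> B \<and> A \<inter> C = {} \<and> even (card A)"

definition double_blocks :: "'a set \<Rightarrow> 'a set set \<Rightarrow> ('a \<times> bool) set set" where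
  "double_blocks Q B = {t. double_layers Q B (layer t False) (layer t True)}"

text \<open>The size of a layer decides what it contributes: a layer of four points is an old block
  and is split by \<open>N\<close>, a layer of two points is itself a pair. Removing
  \<open>{{}}\<close> keeps an empty layer from contributing an empty part.\<close>

definition double_nesting ::
    "('a set \<Rightarrow> 'a set set) \<Rightarrow> ('a \<times> bool) set \<Rightarrow> ('a \<times> bool) set set" where
  "double_nesting N t =
     (\<Union>i. (\<lambda>q. q \<times> {i}) ` (if card (layer t i) = 4 then N (layer t i) else {layer t i} - {{}}))"

lemma double_layers_cases:
  assumes S: "SQS v Q B" and D: "double_layers Q B A C"
  obtains "A = C" "A \<subseteq> Q" "card A = 2"
  | "A \<in> B" "C = {}"
  | "C \<in> B" "A = {}"
  | "A \<union> C \<in> B" "A \<inter> C = {}" "card A = 2" "card C = 2"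
proof (cases "A \<union> C \<in> B \<and> A \<inter> C = {} \<and> even (card A)")
  case True
  then have u: "finite (A \<union> C)" "card (A \<union> C) = 4"
    using SQS_blockD[OF S, of "A \<union> C"] by auto
  then have fin: "finite A" "finite C" by auto
  then have sum: "card A + card C = 4"
    using u True by (simp add: card_Un_disjoint)
  moreover have "even (card A)" using True by blast
  ultimately have "card A = 0 \<or> card A = 2 \<or> card A = 4" by presburger
  then consider "card A = 0" | "card A = 2" | "card A = 4" by (elim disjE)
  then show thesis
  proof cases
    case 1 then show thesis using that(3) True fin by simp
  next
    case 2 then show thesis using that(4) True sum by simp
  next
    case 3 then show thesis using that(2) True fin sum by simp
  qed
next
  case False
  then show thesis using that(1) D unfolding double_layers_def by blast
qed

text \<open>The definition asks only the first layer to be even. The layers of a split old block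
  have four points together, so the second one is even as well.\<close>

lemma double_layers_sym:
  assumes S: "SQS v Q B" shows "double_layers Q B A C \<Longrightarrow> double_layers Q B C A"
  by (erule double_layers_cases[OF S]) (auto simp: double_layers_def Un_commute SQS_blockD(2)[OF S])

lemma in_double_blocks_iff:
  assumes "SQS v Q B"
  shows "t \<in> double_blocks Q B \<longleftrightarrow> double_layers Q B (layer t i) (layer t (\<not> i))"
  using double_layers_sym[OF assms] unfolding double_blocks_def by (cases i) auto

text \<open>A triple has a layer \<open>X\<close> with at least two points and a layer
  \<open>Y\<close> with at most one. If \<open>Y\<close> is a point of \<open>X\<close>, the block
  is the doubled pair \<open>X\<close>. Otherwise \<open>X \<union> Y\<close> is a triple of the old
  system in a unique block \<open>b\<close>, and parity forces the splitting: all of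
  \<open>b\<close> in one layer if \<open>Y\<close> is empty, else \<open>X\<close> and
  \<open>b - X\<close>.\<close>

lemma SQS_double:
  assumes S: "SQS v Q B"
  shows "SQS (2 * v) (Q \<times> UNIV) (double_blocks Q B)"
proof -
  have fQ: "finite Q" "card Q = v" using S by (auto simp: SQS_def)
  have block: "t \<subseteq> Q \<times> UNIV \<and> card t = 4" if "t \<in> double_blocks Q B" for t
  proof -
    have t: "t = glue False (layer t False) (layer t True)"
      using glue_layer[of False t] by simp
    have D: "double_layers Q B (layer t False) (layer t True)"
      using that unfolding double_blocks_def by simp
    have sub: "layer t False \<union> layer t True \<subseteq> Q"
      using D SQS_blockD(1)[OF S] unfolding double_layers_def by blast
    then have fin: "finite (layer t False)" "finite (layer t True)"
      using fQ(1) finite_subset by auto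
    have "card (layer t False) + card (layer t True) = 4"
      using D by (rule double_layers_cases[OF S]) (auto simp: SQS_blockD(2)[OF S])
    then have "card t = 4" using card_glue[OF fin] t by metis
    moreover have "t \<subseteq> Q \<times> UNIV"
      using sub by (subst t) (auto simp: glue_def)
    ultimately show ?thesis by simp
  qed
  have "\<exists>!t. t \<in> double_blocks Q B \<and> T \<subseteq> t" if T: "T \<subseteq> Q \<times> UNIV" "card T = 3" for T
  proof -
    have sub: "layer T i \<subseteq> Q" for i using T(1) by (auto simp: layer_def)
    then have fin: "finite (layer T i)" for i using fQ(1) finite_subset by blast
    have sum: "card (layer T i) + card (layer T (\<not> i)) = 3" for i
      using card_glue[OF fin fin] glue_layer[of i T] T(2) by metis
    \<comment> \<open>Of the three points at most one lies in the smaller layer; \<open>i\<close>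
      names the other layer.\<close>
    obtain i where i: "card (layer T (\<not> i)) \<le> 1"
    proof (cases "card (layer T True) \<le> 1")
      case True then show ?thesis using that[of False] by simp
    next
      case False then show ?thesis using that[of True] sum[of True] by simp
    qed
    define X Y where "X = layer T i" and "Y = layer T (\<not> i)"
    have XY: "X \<subseteq> Q" "Y \<subseteq> Q" "finite X" "finite Y" "card X + card Y = 3" "card Y \<le> 1"
      using sub fin sum i unfolding X_def Y_def by auto
    have "\<exists>A C. (double_layers Q B A C \<and> X \<subseteq> A \<and> Y \<subseteq> C) \<and>
      (\<forall>A' C'. double_layers Q B A' C' \<and> X \<subseteq> A' \<and> Y \<subseteq> C' \<longrightarrow> A' = A \<and> C' = C)"
    proof (cases "Y \<subseteq> X \<and> Y \<noteq> {}")
      case True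
      then have X2: "card X = 2" using XY card_0_eq[of Y] by linarith
      \<comment> \<open>The point of \<open>Y\<close> lies in both layers of the candidate, which
        rules out every case with disjoint layers.\<close>
      have "A' = X \<and> C' = X" if H: "double_layers Q B A' C'" "X \<subseteq> A'" "Y \<subseteq> C'" for A' C'
        using H(1)
      proof (rule double_layers_cases[OF S])
        assume h: "A' = C'" "A' \<subseteq> Q" "card A' = 2"
        then have "finite A'" using fQ(1) finite_subset by blast
        then show ?thesis using h H X2 card_subset_eq[of A' X] by simp
      qed (use True H in auto)
      moreover have "double_layers Q B X X" using X2 XY by (simp add: double_layers_def)
      ultimately show ?thesis using True by blast
    next
      case False
      then have dis: "X \<inter> Y = {}" and Ycases: "Y = {} \<or> card Y = 1"
        using XY by (auto simp: le_Suc_eq card_1_singleton_iff)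
      have "card (X \<union> Y) = 3" using XY dis by (simp add: card_Un_disjoint)
      then have "\<exists>!b. b \<in> B \<and> X \<union> Y \<subseteq> b"
        using SQS_unique_block[OF S, of "X \<union> Y"] XY(1,2) by simp
      then obtain b where b: "b \<in> B" "X \<union> Y \<subseteq> b" and uniq: "\<And>c. c \<in> B \<Longrightarrow> X \<union> Y \<subseteq> c \<Longrightarrow> c = b"
        by metis
      from Ycases show ?thesis
      proof
        assume Y: "Y = {}"
        then have X3: "card X = 3" using XY by simp
        have "A' = b \<and> C' = {}" if H: "double_layers Q B A' C'" "X \<subseteq> A'" "Y \<subseteq> C'" for A' C'
        proof -
          \<comment> \<open>Having three points in \<open>A'\<close> excludes all layers of size 2,
            and also the case of an empty \<open>A'\<close>. Only an old block inside one layer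
            remains.\<close>
          have no2: "card A' \<noteq> 2"
            using card_mono[of A' X] H(2) X3 card.infinite[of A'] by fastforce
          show ?thesis
            using H(1) by (rule double_layers_cases[OF S]) (use no2 H Y X3 uniq in auto)
        qed
        moreover have "double_layers Q B b {}"
          using b SQS_blockD(2)[OF S] by (simp add: double_layers_def)
        ultimately show ?thesis using b Y by blast
      next
        assume Y: "card Y = 1"
        then have X2: "card X = 2" and Y0: "Y \<noteq> {}" and X0: "X \<noteq> {}" using XY by auto
        \<comment> \<open>Both layers are nonempty, so no block inside a single layer fits. A
          doubled pair would have both layers equal to \<open>X\<close>, but \<open>Y\<close> is
          disjoint from \<open>X\<close>. What remains is a 2+2 splitting of
          \<open>b\<close>.\<close>
        have "A' = X \<and> C' = b - X" if H: "double_layers Q B A' C'" "X \<subseteq> A'" "Y \<subseteq> C'" for A' C'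
        proof -
          have eq: "A' = X" if "card A' = 2"
            using card_subset_eq[of A' X] H(2) X2 that card.infinite[of A'] by fastforce
          show ?thesis
            using H(1)
          proof (rule double_layers_cases[OF S])
            assume "A' = C'" "card A' = 2"
            then show ?thesis using eq H Y0 dis by blast
          next
            assume h: "A' \<union> C' \<in> B" "A' \<inter> C' = {}" "card A' = 2"
            then have "A' \<union> C' = b" using uniq H by blast
            then show ?thesis using h eq by blast
          qed (use H X0 Y0 in auto)
        qed
        moreover have "double_layers Q B X (b - X)"
          using b X2 by (auto simp: double_layers_def Un_absorb1)
        moreover have "Y \<subseteq> b - X" using b dis by blast
        ultimately show ?thesis by blast
      qed
    qed
    then obtain A C where AC: "double_layers Q B A C" "X \<subseteq> A" "Y \<subseteq> C"
      and uniq: "\<And>A' C'. double_layers Q B A' C' \<Longrightarrow> X \<subseteq> A' \<Longrightarrow> Y \<subseteq> C' \<Longrightarrow> A' = A \<and> C' = C"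
      by metis
    have T_eq: "T = glue i X Y" unfolding X_def Y_def by (simp only: glue_layer)
    show ?thesis
    proof (rule ex1I[of _ "glue i A C"])
      show "glue i A C \<in> double_blocks Q B \<and> T \<subseteq> glue i A C"
        using AC by (simp add: T_eq in_double_blocks_iff[OF S, of _ i] glue_subset_iff)
      fix t assume "t \<in> double_blocks Q B \<and> T \<subseteq> t"
      then have "layer t i = A \<and> layer t (\<not> i) = C"
        by (intro uniq) (auto simp: T_eq in_double_blocks_iff[OF S, of _ i] glue_subset_iff)
      then show "t = glue i A C" using glue_layer[of i t] by simp
    qed
  qed
  then show ?thesis
    using fQ block unfolding SQS_def by (auto simp: card_cartesian_product)
qed

text \<open>The nesting distinguishes only two shapes, so doubled pairs and 2+2 splittings are
  merged into one case.\<close>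

lemma double_blocks_cases:
  assumes S: "SQS v Q B" and t: "t \<in> double_blocks Q B"
  obtains A i where "A \<in> B" "t = A \<times> {i}"
  | A C where "card A = 2" "card C = 2" "t = A \<times> {False} \<union> C \<times> {True}"
proof -
  have t_eq: "t = layer t False \<times> {False} \<union> layer t True \<times> {True}"
    using glue_layer[of False t] by (simp add: glue_def)
  have "double_layers Q B (layer t False) (layer t True)"
    using t unfolding double_blocks_def by simp
  then show thesis
  proof (rule double_layers_cases[OF S])
    assume "layer t False \<in> B" "layer t True = {}"
    then show thesis using that(1)[of "layer t False" False] t_eq by simp
  next
    assume "layer t True \<in> B" "layer t False = {}"
    then show thesis using that(1)[of "layer t True" True] t_eq by simp
  qed (use that(2) t_eq in metis)+
qed

section \<open>The doubled nesting, its multiplicities and its ND-pairs\<close>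

lemma double_nesting_single_layer:
  assumes "card A = 4"
  shows "double_nesting N (A \<times> {i}) = (\<lambda>q. q \<times> {i}) ` N A"
  using assms unfolding double_nesting_def by (cases i) (auto simp: UNIV_bool)

lemma double_nesting_two_layers:
  assumes "card A = 2" "card C = 2"
  shows "double_nesting N (A \<times> {False} \<union> C \<times> {True}) = {A \<times> {False}, C \<times> {True}}"
proof -
  have "layer (A \<times> {False} \<union> C \<times> {True}) False = A" "layer (A \<times> {False} \<union> C \<times> {True}) True = C"
    by (auto simp: layer_def)
  moreover have "A \<noteq> {}" "C \<noteq> {}" using assms by auto
  ultimately show ?thesis
    using assms unfolding double_nesting_def by (auto simp: UNIV_bool)
qed

lemma Times_singleton_eq_iff: "q \<noteq> {} \<Longrightarrow> q \<times> {i} = r \<times> {j} \<longleftrightarrow> q = r \<and> i = j"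
  by (auto simp: times_eq_iff)

lemma nested_SQS_double:
  assumes N: "nested_SQS v Q B N"
  shows "nested_SQS (2 * v) (Q \<times> UNIV) (double_blocks Q B) (double_nesting N)"
proof -
  have S: "SQS v Q B" using N by (simp add: nested_SQS_def)
  have "partition_on t (double_nesting N t) \<and> card (double_nesting N t) = 2 \<and>
      (\<forall>p\<in>double_nesting N t. card p = 2)" if "t \<in> double_blocks Q B" for t
    using S that
  proof (cases rule: double_blocks_cases)
    case (1 A i)
    have A: "partition_on A (N A)" "card (N A) = 2" "\<forall>p\<in>N A. card p = 2"
      using N 1(1) unfolding nested_SQS_def by auto
    have "partition_on (A \<times> {i}) ((\<lambda>q. q \<times> {i}) ` N A)"
      using A(1) unfolding partition_on_def disjoint_def by (auto simp: eq_commute[of "{}"])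
    moreover have "inj_on (\<lambda>q. q \<times> {i}) (N A)"
      by (auto simp: inj_on_def)
    ultimately show ?thesis
      using A unfolding 1(2) double_nesting_single_layer[OF SQS_blockD(2)[OF S 1(1)]]
      by (auto simp: card_image card_cartesian_product)
  next
    case (2 A C)
    have ne: "A \<noteq> {}" "C \<noteq> {}" using 2 by auto
    then have "partition_on t {A \<times> {False}, C \<times> {True}}"
      unfolding 2(3) by (intro partition_on_doubleton) auto
    moreover have "A \<times> {False} \<noteq> C \<times> {True}" using ne by auto
    ultimately show ?thesis
      using 2(1,2) unfolding double_nesting_two_layers[OF 2(1,2)] 2(3)
      by (auto simp: card_cartesian_product)
  qed
  then show ?thesis using SQS_double[OF S] unfolding nested_SQS_def by blast
qed

text \<open>A block counts for \<open>p \<times> {i}\<close> if its layer \<open>i\<close> is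
  \<open>p\<close>, or is an old block in which \<open>N\<close> has \<open>p\<close> as a part. In
  the first case the other layer is \<open>p\<close> again, or \<open>c - p\<close> for an old block
  \<open>c\<close> through \<open>p\<close>. The division is exact by
  \<open>SQS_pair_degree\<close>.\<close>

lemma multiplicity_double:
  assumes N: "nested_SQS v Q B N" and p: "p \<subseteq> Q" "card p = 2"
  shows "multiplicity (double_blocks Q B) (double_nesting N) (p \<times> {i})
    = 1 + (v - 2) div 2 + multiplicity B N p"
proof -
  have S: "SQS v Q B" using N by (simp add: nested_SQS_def)
  have fB: "finite B" by (rule SQS_finite_blocks[OF S])
  have p0: "p \<noteq> {}" using p by auto
  have mem: "p \<times> {i} \<in> double_nesting N t \<longleftrightarrow>
      (if card (layer t i) = 4 then p \<in> N (layer t i) else layer t i = p)" for t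
  proof -
    have "p \<times> {i} \<in> double_nesting N t \<longleftrightarrow>
        p \<in> (if card (layer t i) = 4 then N (layer t i) else {layer t i} - {{}})"
      unfolding double_nesting_def UN_iff image_iff Times_singleton_eq_iff[OF p0] by blast
    then show ?thesis using p0 by auto
  qed
  let ?D = "{c \<in> B. p \<subseteq> c}" and ?M = "{c \<in> B. p \<in> N c}"
  have "{t \<in> double_blocks Q B. p \<times> {i} \<in> double_nesting N t}
      = {glue i p p} \<union> (\<lambda>c. glue i p (c - p)) ` ?D \<union> (\<lambda>c. glue i c {}) ` ?M" (is "?L = ?R")
  proof
    show "?L \<subseteq> ?R"
    proof
      fix t assume t: "t \<in> ?L"
      let ?A = "layer t i" and ?C = "layer t (\<not> i)"
      have m: "if card ?A = 4 then p \<in> N ?A else ?A = p" using t mem by blast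
      have D: "double_layers Q B ?A ?C" using t in_double_blocks_iff[OF S] by blast
      have "glue i ?A ?C \<in> ?R"
        using D
      proof (rule double_layers_cases[OF S])
        assume "?A = ?C" "?A \<subseteq> Q" "card ?A = 2"
        then show ?thesis using m by simp
      next
        assume "?A \<in> B" "?C = {}"
        then show ?thesis using m SQS_blockD(2)[OF S] by auto
      next
        assume "?A = {}"
        then show ?thesis using m p0 by simp
      next
        assume h: "?A \<union> ?C \<in> B" "?A \<inter> ?C = {}" "card ?A = 2"
        then have "?A = p" using m by simp
        moreover from this h have "?C = (?A \<union> ?C) - p" by blast
        ultimately have "glue i ?A ?C = glue i p (?A \<union> ?C - p)" by metis
        moreover have "?A \<union> ?C \<in> ?D" using h(1) \<open>?A = p\<close> by blast
        ultimately show ?thesis by blast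
      qed
      then show "t \<in> ?R" by (simp only: glue_layer)
    qed
    show "?R \<subseteq> ?L"
      using p SQS_blockD(2)[OF S]
      by (auto simp: mem in_double_blocks_iff[OF S, of _ i] double_layers_def Un_absorb1)
  qed
  moreover have "card ?R = 1 + card ?D + card ?M"
  proof -
    \<comment> \<open>The old block is recovered as the union of \<open>p\<close> and
      \<open>c - p\<close>.\<close>
    have "inj_on (\<lambda>c. glue i p (c - p)) ?D" by (auto simp: inj_on_def glue_eq_iff)
    moreover have "inj_on (\<lambda>c. glue i c {}) ?M" by (auto simp: inj_on_def glue_eq_iff)
    moreover have "glue i p p \<notin> (\<lambda>c. glue i p (c - p)) ` ?D" using p0 by (auto simp: glue_eq_iff)
    \<comment> \<open>Layer \<open>i\<close> has two points in the first two families and four in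
      the third.\<close>
    moreover have "({glue i p p} \<union> (\<lambda>c. glue i p (c - p)) ` ?D) \<inter> (\<lambda>c. glue i c {}) ` ?M = {}"
      using p SQS_blockD(2)[OF S] by (auto simp: glue_eq_iff)
    ultimately show ?thesis using fB by (subst card_Un_disjoint) (auto simp: card_image)
  qed
  moreover have "card ?D = (v - 2) div 2" using SQS_pair_degree[OF S p] by simp
  ultimately show ?thesis unfolding multiplicity_def by simp
qed

text \<open>Every part of the nesting lies inside one layer by construction. Conversely, the summand
  1 in the multiplicity formula, contributed by the block \<open>p \<times> UNIV\<close>, shows that
  each pair inside a layer occurs.\<close>

lemma ND_pairs_double:
  assumes N: "nested_SQS v Q B N"
  shows "ND_pairs (double_blocks Q B) (double_nesting N)
    = (\<lambda>(p, i). p \<times> {i}) ` ({p. p \<subseteq> Q \<and> card p = 2} \<times> UNIV)" (is "?L = ?R")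
proof
  have S: "SQS v Q B" using N by (simp add: nested_SQS_def)
  show "?L \<subseteq> ?R"
  proof
    fix q assume "q \<in> ?L"
    then obtain t where t: "t \<in> double_blocks Q B" "q \<in> double_nesting N t"
      by (auto simp: ND_pairs_def)
    then obtain p i where pi: "q = p \<times> {i}"
      unfolding double_nesting_def by blast
    have "q \<subseteq> t" "card q = 2" "t \<subseteq> Q \<times> UNIV"
      using nested_SQS_pairD[OF nested_SQS_double[OF N] t] SQS_blockD(1)[OF SQS_double[OF S] t(1)]
      by auto
    then show "q \<in> ?R" unfolding pi
      by (intro image_eqI[of _ _ "(p, i)"]) (auto simp: card_cartesian_product)
  qed
  show "?R \<subseteq> ?L"
  proof
    fix q assume "q \<in> ?R"
    then obtain p i where "q = p \<times> {i}" "p \<subseteq> Q" "card p = 2" by auto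
    then have "multiplicity (double_blocks Q B) (double_nesting N) q \<noteq> 0"
      using multiplicity_double[OF N] by simp
    then show "q \<in> ?L" unfolding multiplicity_def ND_pairs_def
      by (metis (mono_tags, lifting) card.empty empty_Collect_eq mem_Collect_eq)
  qed
qed

section \<open>Number of ND-pairs and conclusion\<close>

lemma real_choose_two: "real (n choose 2) = real n * (real n - 1) / 2"
proof -
  have "2 * (n choose 2) = n * (n - 1)" by (cases n) (auto simp: choose_two)
  then have "2 * real (n choose 2) = real n * real (n - 1)" by (metis of_nat_mult of_nat_numeral)
  then show ?thesis by (cases n) auto
qed

lemma minimum_uniform_nested_SQS_double:
  assumes C: "complete_uniform_nested_SQS v Q B N"
  shows "minimum_uniform_nested_SQS (2 * v) (Q \<times> UNIV) (double_blocks Q B) (double_nesting N)"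
proof -
  have U: "uniform_nested_SQS v Q B N" and ND: "ND_pairs B N = {p. p \<subseteq> Q \<and> card p = 2}"
    using C by (simp_all only: complete_uniform_nested_SQS_def)
  have N: "nested_SQS v Q B N"
    using U by (simp only: uniform_nested_SQS_def)
  \<comment> \<open>Completeness makes the old multiplicity constant over all pairs of
    \<open>Q\<close>. Every other term of \<open>multiplicity_double\<close> depends on
    \<open>v\<close> alone.\<close>
  have unif: "multiplicity B N p = multiplicity B N q"
    if "p \<subseteq> Q" "card p = 2" "q \<subseteq> Q" "card q = 2" for p q
    using U that unfolding uniform_nested_SQS_def ND by blast
  have Q: "finite Q" "card Q = v" using N by (auto simp: nested_SQS_def SQS_def)
  have "inj_on (\<lambda>(p, i). p \<times> {i}) ({p. p \<subseteq> Q \<and> card p = 2} \<times> (UNIV :: bool set))"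
    by (auto simp: inj_on_def times_eq_iff)
  \<comment> \<open>This is \<open>v * (v - 1)\<close>, the required count for a system on
    \<open>2 * v\<close> points.\<close>
  then have "card (ND_pairs (double_blocks Q B) (double_nesting N)) = (v choose 2) * 2"
    using n_subsets[OF Q(1), of 2] Q(2)
    by (simp add: ND_pairs_double[OF N] card_image card_cartesian_product)
  moreover have "multiplicity (double_blocks Q B) (double_nesting N) p
      = multiplicity (double_blocks Q B) (double_nesting N) q"
    if pq: "p \<in> ND_pairs (double_blocks Q B) (double_nesting N)"
      "q \<in> ND_pairs (double_blocks Q B) (double_nesting N)" for p q
  proof -
    obtain p' i where "p = p' \<times> {i}" "p' \<subseteq> Q" "card p' = 2"
      using pq(1) unfolding ND_pairs_double[OF N] by auto
    moreover obtain q' j where "q = q' \<times> {j}" "q' \<subseteq> Q" "card q' = 2"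
      using pq(2) unfolding ND_pairs_double[OF N] by auto
    ultimately show ?thesis using unif[of p' q'] by (simp add: multiplicity_double[OF N])
  qed
  then have "uniform_nested_SQS (2 * v) (Q \<times> UNIV) (double_blocks Q B) (double_nesting N)"
    using nested_SQS_double[OF N] unfolding uniform_nested_SQS_def by blast
  ultimately show ?thesis
    by (simp add: minimum_uniform_nested_SQS_def real_choose_two)
qed

theorem theorem4p4:
  fixes v :: nat
  assumes "\<exists>(Q :: 'a set) B N. complete_uniform_nested_SQS v Q B N"
  shows "\<exists>(Q :: nat set) B N. minimum_uniform_nested_SQS (2 * v) Q B N"
proof -
  obtain Q :: "'a set" and B N where "complete_uniform_nested_SQS v Q B N"
    using assms by blast
  from minimum_uniform_nested_SQS_double[OF this]
  have M: "minimum_uniform_nested_SQS (2 * v)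
      (Q \<times> (UNIV :: bool set)) (double_blocks Q B) (double_nesting N)" .
  \<comment> \<open>A finite point set embeds into the natural numbers, and the system is carried
    along the embedding.\<close>
  then have "finite (Q \<times> (UNIV :: bool set))"
    by (simp only: minimum_uniform_nested_SQS_def uniform_nested_SQS_def nested_SQS_def SQS_def)
  then obtain f :: "'a \<times> bool \<Rightarrow> nat" where "inj_on f (Q \<times> UNIV)"
    using finite_imp_inj_to_nat_seg by blast
  from minimum_uniform_nested_SQS_image[OF M this] show ?thesis by blast
qed

end
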